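(* Let $g(z)=z+\sum_{n\ge 2}g_nz^n\in\mathbb{A}$, write $[n]_g=g_n$, and let $\phi(z)=1+B_1z+B_2z^2+\cdots$ be as in the context. If $f(z)=z+\sum_{n\ge2}a_nz^n\in\mathbb{A}$ belongs to $\mathcal{C}_g(\phi)$, then for every complex number $\mu$, $$|a_3-\mu a_2^2|\le\frac{B_1}{[3]_g([3]_g-1)}\max\left\{1,\left|\frac{B_2}{B_1}+\frac{B_1}{[2]_g-1}\left(1-\frac{[3]_g([3]_g-1)}{[2]_g^2([2]_g-1)}\mu\right)\right|\right\}.$$
   Context: $\mathbb{U}=\{z\in\mathbb{C}:|z|<1\}$, and $\mathbb{A}$ is the set of analytic functions $f$ on $\mathbb{U}$ with $f(0)=0$, $f'(0)=1$, i.e. $f(z)=z+\sum_{n\ge2}a_nz^n$. For analytic $F,\phi$ on $\mathbb{U}$, $F\prec\phi$ (subordination) means there is an analytic $u$ on $\mathbb{U}$ with $u(0)=0$, $|u(z)|<1$ and $F(z)=\phi(u(z))$ for all $z\in\mathbb{U}$. For $g(z)=z+\sum_{n\ge2}g_nz^n\in\mathbb{A}$, the $g$-derivative of $f\in\mathbb{A}$ is $D_gf(z)=\frac1z\left(z+\sum_{n\ge2}[n]_ga_nz^n\right)$, where $[n]_g=g_n$ (so $zD_gf\in\mathbb{A}$ is the convolution, i.e. Hadamard product, of $f$ and $g$). The function $\phi$ is analytic on $\mathbb{U}$ with positive real part, $\phi(0)=1$, $\phi'(0)>0$, $\phi(\mathbb{U})$ symmetric with respect to the real axis, with expansion $\phi(z)=1+B_1z+B_2z^2+B_3z^3+\cdots$,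 $B_1>0$. The class $\mathcal{C}_g(\phi)$ consists of all $f\in\mathbb{A}$ such that $\frac{D_g(zD_gf(z))}{D_gf(z)}\prec\phi(z)$.
   Formalization: The outer factor is taken as B_1/|[3]_g([3]_g-1)|, since the printed bound fails for f(z)=z when [3]_g([3]_g-1)<0 and is meaningless when it is not real; [2]_g and [3]_g are assumed different from 0 and 1 so that the denominators do not vanish. *)

theory Defs
  imports "HOL-Complex_Analysis.Complex_Analysis"
begin

abbreviation unit_disc :: "complex set" where
  "unit_disc \<equiv> ball 0 1"

definition taylor_coeff :: "(complex \<Rightarrow> complex) \<Rightarrow> nat \<Rightarrow> complex" where
  "taylor_coeff f n = fps_nth (fps_expansion f 0) n"

definition normalized_class :: "(complex \<Rightarrow> complex) set" where
  "normalized_class = {f. f holomorphic_on unit_disc \<and> f 0 = 0 \<and> deriv f 0 = 1}"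

definition subordinate :: "(complex \<Rightarrow> complex) \<Rightarrow> (complex \<Rightarrow> complex) \<Rightarrow> bool" where
  "subordinate F \<phi> \<longleftrightarrow>
     F holomorphic_on unit_disc \<and> \<phi> holomorphic_on unit_disc \<and>
     (\<exists>u. u holomorphic_on unit_disc \<and> u 0 = 0 \<and>
          (\<forall>z\<in>unit_disc. cmod (u z) < 1 \<and> F z = \<phi> (u z)))"

text \<open>These numbers are complex in general, so a real bound with a denominator built from them
  has to take its modulus; this changes nothing when the denominator is a positive real.\<close>

definition g_number :: "(complex \<Rightarrow> complex) \<Rightarrow> nat \<Rightarrow> complex" where
  "g_number g n = taylor_coeff g n"

text \<open>The defining formula of the \<open>g\<close>-derivative has a removable singularity at \<open>0\<close>,
  where it is given its limit \<open>1\<close>.\<close>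

definition g_derivative :: "(complex \<Rightarrow> complex) \<Rightarrow> (complex \<Rightarrow> complex) \<Rightarrow> complex \<Rightarrow> complex" where
  "g_derivative g f z =
     (if z = 0 then 1
      else (1 / z) * (z + (\<Sum>n. g_number g (n + 2) * taylor_coeff f (n + 2) * z ^ (n + 2))))"

text \<open>Univalence of \<open>\<phi>\<close> is not required. The condition on \<open>deriv \<phi> 0\<close> says that it is a
  positive real number.\<close>

definition admissible :: "(complex \<Rightarrow> complex) \<Rightarrow> bool" where
  "admissible \<phi> \<longleftrightarrow>
     \<phi> holomorphic_on unit_disc \<and> (\<forall>z\<in>unit_disc. Re (\<phi> z) > 0) \<and> \<phi> 0 = 1 \<and>
     deriv \<phi> 0 \<in> \<real> \<and> Re (deriv \<phi> 0) > 0 \<and>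
     cnj ` (\<phi> ` unit_disc) = \<phi> ` unit_disc"

text \<open>The quotient \<open>D\<^sub>g (z D\<^sub>g f) / D\<^sub>g f\<close> is understood as an analytic function \<open>F\<close> on
  the disc: at a zero of the denominator (where HOL division would give \<open>0\<close>) the value of \<open>F\<close>
  is the one given by removing the singularity. The denominator is \<open>1\<close> at \<open>0\<close>, so \<open>F\<close> is unique
  on the disc.\<close>

definition class_C :: "(complex \<Rightarrow> complex) \<Rightarrow> (complex \<Rightarrow> complex) \<Rightarrow> (complex \<Rightarrow> complex) set" where
  "class_C g \<phi> =
     {f \<in> normalized_class. \<exists>F. subordinate F \<phi> \<and>
        (\<forall>z\<in>unit_disc. g_derivative g f z \<noteq> 0 \<longrightarrow>
           F z = g_derivative g (\<lambda>w. w * g_derivative g f w) z / g_derivative g f z)}"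

end

theory Submission
  imports Defs
begin

text \<open>
  Let \<open>D = 1 + [2]\<^sub>g a\<^sub>2 z + [3]\<^sub>g a\<^sub>3 z\<^sup>2 + \<dots>\<close> be the \<open>g\<close>-derivative of \<open>f\<close>.  Applying the
  operator to \<open>z D\<close> multiplies the Taylor coefficients by the \<open>g\<close>-numbers once more, so that
  membership in the class says, with a Schwarz function \<open>u = c\<^sub>1 z + c\<^sub>2 z\<^sup>2 + \<dots>\<close>,
  \<open>\<phi>(u(z)) (1 + [2]\<^sub>g a\<^sub>2 z + [3]\<^sub>g a\<^sub>3 z\<^sup>2 + \<dots>) = 1 + [2]\<^sub>g\<^sup>2 a\<^sub>2 z + [3]\<^sub>g\<^sup>2 a\<^sub>3 z\<^sup>2 + \<dots>\<close>
  near \<open>0\<close>, where \<open>D\<close> has no zero.  Comparing coefficients gives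
  \<open>[2]\<^sub>g ([2]\<^sub>g - 1) a\<^sub>2 = B\<^sub>1 c\<^sub>1\<close> and
  \<open>[3]\<^sub>g ([3]\<^sub>g - 1) a\<^sub>3 = B\<^sub>1 c\<^sub>2 + (B\<^sub>2 + B\<^sub>1\<^sup>2 / ([2]\<^sub>g - 1)) c\<^sub>1\<^sup>2\<close>.  Hence
  \<open>a\<^sub>3 - \<mu> a\<^sub>2\<^sup>2 = B\<^sub>1 / ([3]\<^sub>g ([3]\<^sub>g - 1)) (c\<^sub>2 + t c\<^sub>1\<^sup>2)\<close>, where \<open>t\<close> is exactly the number whose
  modulus occurs in the maximum.

  This leaves the bound \<open>|c\<^sub>2 + t c\<^sub>1\<^sup>2| \<le> max {1, |t|}\<close> for Schwarz functions
  (\<open>Schwarz_Fekete_Szego\<close>), a consequence of \<open>|c\<^sub>2| \<le> 1 - |c\<^sub>1|\<^sup>2\<close>, which in turn is the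
  Schwarz-Pick inequality at \<open>0\<close> for \<open>u(z) / z\<close>.

  These identities are between formal power series of germs at \<open>0\<close>.  The only question of
  convergence is therefore that the Hadamard product of two convergent series has a positive
  radius of convergence, which makes the series in the definition of the \<open>g\<close>-derivative an
  expansion of a function near \<open>0\<close> (\<open>g_derivative_has_fps_expansion\<close>).
\<close>

lemma has_fps_expansion_eventually_eq:
  assumes "f has_fps_expansion F" and "eventually (\<lambda>z. g z = f z) (nhds 0)"
  shows "g has_fps_expansion F"
  using has_fps_expansion_cong[OF assms(2) refl] assms(1) by simp

section \<open>Coefficients of Schwarz functions\<close>

text \<open>
  Following \<open>h\<close> by the disc automorphism that sends \<open>h 0\<close> to \<open>0\<close> reduces this to the Schwarz
  lemma; the derivative of that automorphism at \<open>h 0\<close> is \<open>1 / (1 - |h 0|\<^sup>2)\<close>.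
\<close>

lemma Schwarz_Pick_at_0:
  assumes hol: "h holomorphic_on ball 0 1"
    and lt1: "\<And>z. cmod z < 1 \<Longrightarrow> cmod (h z) < 1"
  shows "cmod (deriv h 0) \<le> 1 - (cmod (h 0))\<^sup>2"
proof -
  define a where "a = h 0"
  have a: "cmod a < 1"
    using lt1[of 0] by (simp add: a_def)
  define m where "m = Moebius_function 0 a"
  have "m \<circ> h holomorphic_on ball 0 1"
    unfolding m_def using lt1 a
    by (intro holomorphic_on_compose_gen[OF hol Moebius_function_holomorphic]) auto
  moreover have "(m \<circ> h) 0 = 0"
    by (simp add: m_def a_def Moebius_function_eq_zero)
  moreover have "cmod ((m \<circ> h) z) < 1" if "cmod z < 1" for z
    using Moebius_function_norm_lt_1[OF a lt1[OF that]] by (simp add: m_def)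
  ultimately have le1: "cmod (deriv (m \<circ> h) 0) \<le> 1"
    by (rule Schwarz_Lemma(2)[where \<xi> = 0]) auto
  have pos: "0 < 1 - (cmod a)\<^sup>2"
    using a by (simp add: power_less_one_iff)
  have q: "1 - cnj a * a = of_real (1 - (cmod a)\<^sup>2)"
    by (simp add: mult.commute complex_norm_square del: of_real_power)
  with pos have nz: "1 - cnj a * a \<noteq> 0"
    by (metis less_irrefl of_real_eq_0_iff)
  have "(m has_field_derivative 1 / (1 - cnj a * a)) (at (h 0))"
    unfolding m_def Moebius_function_simple[abs_def] a_def[symmetric] using nz
    by (auto intro!: derivative_eq_intros simp: divide_simps)
  moreover have "(h has_field_derivative deriv h 0) (at 0)"
    by (intro holomorphic_derivI[OF hol]) auto
  ultimately have "deriv (m \<circ> h) 0 = 1 / (1 - cnj a * a) * deriv h 0"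
    by (intro DERIV_imp_deriv DERIV_chain)
  hence "cmod (deriv (m \<circ> h) 0) = cmod (deriv h 0) / (1 - (cmod a)\<^sup>2)"
    unfolding q using pos by (simp add: norm_mult norm_divide del: of_real_diff)
  with le1 pos show ?thesis
    by (simp add: a_def divide_simps)
qed

text \<open>
  The quotient \<open>h(z) = u(z) / z\<close> has \<open>h(0) = c\<^sub>1\<close> and \<open>h'(0) = c\<^sub>2\<close>.  By the Schwarz lemma it either
  maps the disc into itself, and Schwarz-Pick applies, or \<open>u\<close> is a rotation, and then \<open>|c\<^sub>1| = 1\<close>
  and \<open>c\<^sub>2 = 0\<close>.
\<close>

lemma Schwarz_second_coeff:
  assumes hol: "u holomorphic_on ball 0 1" and u0: "u 0 = 0"
    and lt1: "\<And>z. cmod z < 1 \<Longrightarrow> cmod (u z) < 1"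
    and U: "u has_fps_expansion U"
  shows "cmod (fps_nth U 2) \<le> 1 - (cmod (fps_nth U 1))\<^sup>2"
proof -
  obtain h where h: "h holomorphic_on ball 0 1" "\<And>z. cmod z < 1 \<Longrightarrow> u z = z * h z"
      and u': "deriv u 0 = h 0"
    using Schwarz3[OF hol u0] by metis
  have H: "h has_fps_expansion fps_expansion h 0"
    by (rule has_fps_expansion_fps_expansion[OF _ _ h(1)]) auto
  have "(\<lambda>z. z * h z) has_fps_expansion fps_X * fps_expansion h 0"
    by (intro fps_expansion_intros H)
  moreover have "eventually (\<lambda>z. u z = z * h z) (nhds 0)"
    using eventually_nhds_in_open[of "ball 0 1" "0::complex"] h(2) by (auto elim!: eventually_mono)
  ultimately have "u has_fps_expansion fps_X * fps_expansion h 0"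
    by (rule has_fps_expansion_eventually_eq)
  with U have UX: "U = fps_X * fps_expansion h 0"
    by (rule fps_expansion_unique_complex)
  have c1: "fps_nth U 1 = h 0" and c2: "fps_nth U 2 = deriv h 0"
    by (simp_all add: UX fps_expansion_def)
  show ?thesis
  proof (cases "\<exists>z. cmod z < 1 \<and> cmod (h z) \<ge> 1")
    case False
    then show ?thesis
      unfolding c1 c2 by (intro Schwarz_Pick_at_0 h(1)) (auto simp: not_le)
  next
    case True
    then obtain z where z: "cmod z < 1" "cmod (h z) \<ge> 1" by blast
    note Schwarz = Schwarz_Lemma[OF hol u0 lt1 z(1)]
    have "(\<exists>z. cmod z < 1 \<and> z \<noteq> 0 \<and> cmod (u z) = cmod z) \<or> cmod (deriv u 0) = 1"
    proof (cases "z = 0")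
      case True
      then show ?thesis using Schwarz(2) z(2) u' by simp
    next
      case False
      have "cmod z * 1 \<le> cmod (u z)"
        unfolding h(2)[OF z(1)] norm_mult by (intro mult_left_mono z(2) norm_ge_zero)
      with Schwarz(1) have "cmod (u z) = cmod z" by simp
      with False z(1) show ?thesis by blast
    qed
    from Schwarz(3)[OF _ this]
    obtain \<alpha> where \<alpha>: "\<And>z. cmod z < 1 \<Longrightarrow> u z = \<alpha> * z" "cmod \<alpha> = 1" by blast
    have "(\<lambda>z. \<alpha> * z) has_fps_expansion fps_const \<alpha> * fps_X"
      by (intro fps_expansion_intros)
    moreover have "eventually (\<lambda>z. u z = \<alpha> * z) (nhds 0)"
      using eventually_nhds_in_open[of "ball 0 1" "0::complex"] \<alpha>(1)
      by (auto elim!: eventually_mono)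
    ultimately have "u has_fps_expansion fps_const \<alpha> * fps_X"
      by (rule has_fps_expansion_eventually_eq)
    with U have "U = fps_const \<alpha> * fps_X"
      by (rule fps_expansion_unique_complex)
    then show ?thesis
      using \<alpha>(2) by simp
  qed
qed

text \<open>
  The left-hand side is at most \<open>(1 - |c\<^sub>1|\<^sup>2) \<cdot> 1 + |c\<^sub>1|\<^sup>2 \<cdot> |t|\<close>, a convex combination of \<open>1\<close>
  and \<open>|t|\<close>.
\<close>

lemma Schwarz_Fekete_Szego:
  assumes "u holomorphic_on ball 0 1" and "u 0 = 0"
    and "\<And>z. cmod z < 1 \<Longrightarrow> cmod (u z) < 1"
    and "u has_fps_expansion U"
  shows "cmod (fps_nth U 2 + t * (fps_nth U 1)\<^sup>2) \<le> max 1 (cmod t)"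
proof -
  let ?s = "(cmod (fps_nth U 1))\<^sup>2"
  have c2: "cmod (fps_nth U 2) \<le> 1 - ?s"
    by (rule Schwarz_second_coeff[OF assms])
  hence s: "?s \<le> 1"
    using norm_ge_zero[of "fps_nth U 2"] by linarith
  have "cmod (fps_nth U 2 + t * (fps_nth U 1)\<^sup>2) \<le> cmod (fps_nth U 2) + cmod t * ?s"
    by (metis norm_mult norm_power norm_triangle_ineq)
  also have "\<dots> \<le> (1 - ?s) * 1 + ?s * cmod t"
    using c2 by simp
  also have "\<dots> \<le> (1 - ?s) * max 1 (cmod t) + ?s * max 1 (cmod t)"
    using s by (intro add_mono mult_left_mono) auto
  finally show ?thesis
    by (simp add: algebra_simps)
qed

section \<open>The Taylor expansion of the \<open>g\<close>-derivative\<close>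

definition fps_hadamard :: "'a::times fps \<Rightarrow> 'a fps \<Rightarrow> 'a fps" where
  "fps_hadamard F G = Abs_fps (\<lambda>n. fps_nth F n * fps_nth G n)"

lemma fps_nth_hadamard [simp]: "fps_nth (fps_hadamard F G) n = fps_nth F n * fps_nth G n"
  by (simp add: fps_hadamard_def)

text \<open>
  If both series converge at some \<open>r > 0\<close>, then the terms of one are summable at \<open>r\<close> and those of
  the other bounded, so the Hadamard product converges absolutely at \<open>r\<^sup>2\<close>.
\<close>

lemma fps_conv_radius_hadamard_pos:
  fixes F G :: "complex fps"
  assumes "fps_conv_radius F > 0" "fps_conv_radius G > 0"
  shows "fps_conv_radius (fps_hadamard F G) > 0"
proof -
  obtain r :: real where r: "0 < r" "ereal r < fps_conv_radius F" "ereal r < fps_conv_radius G"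
    using assms ereal_dense2[of 0 "min (fps_conv_radius F) (fps_conv_radius G)"]
    by (auto simp: zero_ereal_def)
  let ?z = "of_real r :: complex"
  have F: "summable (\<lambda>n. norm (fps_nth F n * ?z ^ n))"
    using r by (intro abs_summable_in_conv_radius) (simp add: fps_conv_radius_def)
  have "Bseq (\<lambda>n. fps_nth G n * ?z ^ n)"
    using r by (intro summable_imp_Bseq summable_in_conv_radius) (simp add: fps_conv_radius_def)
  then obtain K where K: "\<And>n. norm (fps_nth G n * ?z ^ n) \<le> K"
    unfolding Bseq_def by blast
  have "summable (\<lambda>n. fps_nth (fps_hadamard F G) n * (?z\<^sup>2) ^ n)"
  proof (rule summable_comparison_test')
    show "summable (\<lambda>n. K * norm (fps_nth F n * ?z ^ n))"
      by (rule summable_mult[OF F])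
    fix n :: nat
    have "norm (fps_nth (fps_hadamard F G) n * (?z\<^sup>2) ^ n)
          = norm (fps_nth G n * ?z ^ n) * norm (fps_nth F n * ?z ^ n)"
      by (simp add: norm_mult power_mult_distrib power2_eq_square)
    also have "\<dots> \<le> K * norm (fps_nth F n * ?z ^ n)"
      by (intro mult_right_mono K) auto
    finally show "norm (fps_nth (fps_hadamard F G) n * (?z\<^sup>2) ^ n)
          \<le> K * norm (fps_nth F n * ?z ^ n)" .
  qed
  hence "ereal (norm (?z\<^sup>2)) \<le> fps_conv_radius (fps_hadamard F G)"
    unfolding fps_conv_radius_def by (rule conv_radius_geI)
  moreover have "0 < ereal (norm (?z\<^sup>2))"
    using r by simp
  ultimately show ?thesis
    by (rule less_le_trans[rotated])
qed

lemma taylor_coeff_eq: "f has_fps_expansion F \<Longrightarrow> taylor_coeff f n = fps_nth F n"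
  by (simp add: taylor_coeff_def fps_expansion_eqI)

text \<open>
  The assumptions on \<open>F\<close> and \<open>G\<close> make the Hadamard product start with \<open>z\<close>.  These two terms are
  the ones that the definition of the \<open>g\<close>-derivative writes out separately, and the division by
  \<open>z\<close> with value \<open>1\<close> at the origin becomes a shift of the series.  The assumptions concern germs at \<open>0\<close>, so the lemma can be
  applied again to \<open>z D\<^sub>g f\<close>, whose expansion is known only near \<open>0\<close>.
\<close>

lemma g_derivative_has_fps_expansion:
  assumes F: "f has_fps_expansion F" "fps_nth F 0 = 0" "fps_nth F 1 = 1"
    and G: "g has_fps_expansion G" "fps_nth G 1 = 1"
  shows "g_derivative g f has_fps_expansion fps_shift 1 (fps_hadamard G F)"
proof -
  let ?P = "fps_hadamard G F"
  have pos: "fps_conv_radius ?P > 0"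
    using F(1) G(1) by (intro fps_conv_radius_hadamard_pos) (auto simp: has_fps_expansion_def)
  have "?P \<noteq> 0"
    using F(3) G(2) by (metis fps_nth_hadamard fps_zero_nth mult_1 zero_neq_one)
  hence "1 \<le> subdegree ?P"
    using F(2) by (intro subdegree_geI) auto
  hence "(\<lambda>z. if z = 0 then 1 else eval_fps ?P z / z ^ 1) has_fps_expansion fps_shift 1 ?P"
    using F G by (intro has_fps_expansion_shift eval_fps_has_fps_expansion pos) auto
  moreover have "eventually (\<lambda>z. z \<in> eball 0 (fps_conv_radius ?P)) (nhds 0)"
    using pos by (intro eventually_nhds_in_open) (auto simp: zero_ereal_def)
  hence "eventually (\<lambda>z. g_derivative g f z = (if z = 0 then 1 else eval_fps ?P z / z ^ 1)) (nhds 0)"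
  proof eventually_elim
    case (elim z)
    have "summable (\<lambda>n. fps_nth ?P n * z ^ n)"
      using elim by (intro summable_fps) auto
    from suminf_split_initial_segment[OF this, of 2]
    have "eval_fps ?P z = z + (\<Sum>n. fps_nth ?P (n + 2) * z ^ (n + 2))"
      using F(2,3) G(2) by (simp add: eval_fps_def numeral_2_eq_2)
    then show ?case
      by (simp add: g_derivative_def g_number_def taylor_coeff_eq[OF F(1)] taylor_coeff_eq[OF G(1)])
  qed
  ultimately show ?thesis
    by (rule has_fps_expansion_eventually_eq)
qed

lemma normalized_class_fps_expansion:
  assumes "f \<in> normalized_class"
  obtains F where "f has_fps_expansion F" "fps_nth F 0 = 0" "fps_nth F 1 = 1"
proof
  show "f has_fps_expansion fps_expansion f 0"
    using assms by (intro has_fps_expansion_fps_expansion[of unit_disc])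
      (auto simp: normalized_class_def)
qed (use assms in \<open>auto simp: normalized_class_def fps_expansion_def\<close>)

section \<open>The coefficient inequality\<close>

text \<open>
  The quotient condition is multiplied out to \<open>\<phi>(u) D\<^sub>g f = D\<^sub>g (z D\<^sub>g f)\<close> near \<open>0\<close>, where
  \<open>D\<^sub>g f\<close> is close to its value \<open>1\<close> and hence nonzero; equality of the germs is equality of the
  power series.
\<close>

lemma class_C_subordination_fps:
  assumes F: "f has_fps_expansion F" "fps_nth F 0 = 0" "fps_nth F 1 = 1"
    and G: "g has_fps_expansion G" "fps_nth G 1 = 1"
    and f: "f \<in> class_C g \<phi>" and \<Phi>: "\<phi> has_fps_expansion \<Phi>"
  obtains u U where "u holomorphic_on unit_disc" "u 0 = 0"
    "\<And>z. cmod z < 1 \<Longrightarrow> cmod (u z) < 1" "u has_fps_expansion U" "fps_nth U 0 = 0"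
    "(\<Phi> oo U) * fps_shift 1 (fps_hadamard G F)
       = fps_shift 1 (fps_hadamard G (fps_hadamard G F))"
proof -
  let ?P = "fps_hadamard G F"
  let ?D = "g_derivative g f" and ?N = "g_derivative g (\<lambda>w. w * g_derivative g f w)"
  obtain Q u where u: "u holomorphic_on unit_disc" "u 0 = 0"
      "\<And>z. z \<in> unit_disc \<Longrightarrow> cmod (u z) < 1 \<and> Q z = \<phi> (u z)"
    and Q: "\<And>z. z \<in> unit_disc \<Longrightarrow> ?D z \<noteq> 0 \<Longrightarrow> Q z = ?N z / ?D z"
    using f unfolding class_C_def subordinate_def by blast
  have D: "?D has_fps_expansion fps_shift 1 ?P"
    by (rule g_derivative_has_fps_expansion[OF F G])
  have "(\<lambda>w. w * ?D w) has_fps_expansion fps_X * fps_shift 1 ?P"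
    by (intro fps_expansion_intros D)
  also have "fps_X * fps_shift 1 ?P = ?P"
    using F(2) by (intro fps_ext) auto
  finally have N: "?N has_fps_expansion fps_shift 1 (fps_hadamard G ?P)"
    by (rule g_derivative_has_fps_expansion) (use F G in auto)
  have U: "u has_fps_expansion fps_expansion u 0"
    by (rule has_fps_expansion_fps_expansion[OF _ _ u(1)]) auto
  have U0: "fps_nth (fps_expansion u 0) 0 = 0"
    by (simp add: fps_expansion_def u(2))
  have prod: "(\<lambda>z. (\<phi> \<circ> u) z * ?D z) has_fps_expansion
      (\<Phi> oo fps_expansion u 0) * fps_shift 1 ?P"
    by (intro has_fps_expansion_mult has_fps_expansion_compose \<Phi> U U0 D)
  have "isCont ?D 0"
    using has_fps_expansion_imp_continuous[OF D, of UNIV] by simp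
  moreover have "?D 0 \<noteq> 0"
    by (simp add: g_derivative_def)
  ultimately have "eventually (\<lambda>z. ?D z \<noteq> 0) (nhds 0)"
    using tendsto_imp_eventually_ne[of ?D "?D 0" "nhds 0" 0] by (simp add: isCont_def tendsto_at_iff_tendsto_nhds)
  moreover have "eventually (\<lambda>z::complex. z \<in> unit_disc) (nhds 0)"
    by (intro eventually_nhds_in_open) auto
  ultimately have "eventually (\<lambda>z. ?N z = (\<phi> \<circ> u) z * ?D z) (nhds 0)"
  proof eventually_elim
    case (elim z)
    then show ?case using Q[of z] u(3)[of z] by simp
  qed
  with prod have "?N has_fps_expansion (\<Phi> oo fps_expansion u 0) * fps_shift 1 ?P"
    by (rule has_fps_expansion_eventually_eq)
  from fps_expansion_unique_complex[OF this N] show ?thesis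
    using u by (intro that[OF _ _ _ U U0]) auto
qed

theorem theorem3p5:
  fixes f g \<phi> :: "complex \<Rightarrow> complex" and \<mu> :: complex
  assumes g: "g \<in> normalized_class"
    and \<phi>: "admissible \<phi>"
    and f: "f \<in> class_C g \<phi>"
    and g2: "g_number g 2 \<noteq> 0" "g_number g 2 \<noteq> 1"
    and g3: "g_number g 3 \<noteq> 0" "g_number g 3 \<noteq> 1"
  shows "cmod (taylor_coeff f 3 - \<mu> * (taylor_coeff f 2)\<^sup>2)
    \<le> Re (taylor_coeff \<phi> 1) / cmod (g_number g 3 * (g_number g 3 - 1)) *
      max 1 (cmod (taylor_coeff \<phi> 2 / taylor_coeff \<phi> 1 +
        taylor_coeff \<phi> 1 / (g_number g 2 - 1) *
        (1 - g_number g 3 * (g_number g 3 - 1) /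
             ((g_number g 2)\<^sup>2 * (g_number g 2 - 1)) * \<mu>)))"
proof -
  obtain G where G: "g has_fps_expansion G" "fps_nth G 0 = 0" "fps_nth G 1 = 1"
    using g by (rule normalized_class_fps_expansion)
  obtain F where F: "f has_fps_expansion F" "fps_nth F 0 = 0" "fps_nth F 1 = 1"
    using f normalized_class_fps_expansion unfolding class_C_def by blast
  have \<phi>': "\<phi> holomorphic_on unit_disc" "\<phi> 0 = 1" "deriv \<phi> 0 \<in> \<real>" "Re (deriv \<phi> 0) > 0"
    using \<phi> by (auto simp: admissible_def)
  define \<Phi> where "\<Phi> = fps_expansion \<phi> 0"
  have \<Phi>: "\<phi> has_fps_expansion \<Phi>"
    unfolding \<Phi>_def by (rule has_fps_expansion_fps_expansion[OF _ _ \<phi>'(1)]) auto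
  obtain u U where u: "u holomorphic_on unit_disc" "u 0 = 0"
      "\<And>z. cmod z < 1 \<Longrightarrow> cmod (u z) < 1" "u has_fps_expansion U"
    and U0: "fps_nth U 0 = 0"
    and eq: "(\<Phi> oo U) * fps_shift 1 (fps_hadamard G F)
               = fps_shift 1 (fps_hadamard G (fps_hadamard G F))"
    using class_C_subordination_fps[OF F G(1,3) f \<Phi>] by metis
  define B1 B2 where "B1 = fps_nth \<Phi> 1" and "B2 = fps_nth \<Phi> 2"
  define c1 c2 where "c1 = fps_nth U 1" and "c2 = fps_nth U 2"
  define a2 a3 where "a2 = fps_nth F 2" and "a3 = fps_nth F 3"
  define x y where "x = fps_nth G 2" and "y = fps_nth G 3"
  note coeff_defs = B1_def B2_def c1_def c2_def a2_def a3_def x_def y_def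
  have tc: "taylor_coeff f 3 = a3" "taylor_coeff f 2 = a2" "g_number g 2 = x" "g_number g 3 = y"
      "taylor_coeff \<phi> 1 = B1" "taylor_coeff \<phi> 2 = B2"
    using taylor_coeff_eq[OF F(1)] taylor_coeff_eq[OF G(1)] taylor_coeff_eq[OF \<Phi>]
    by (simp_all add: g_number_def coeff_defs)
  note nz = g2[unfolded tc] g3[unfolded tc]
  have "B1 = deriv \<phi> 0"
    by (simp add: B1_def \<Phi>_def fps_expansion_def)
  with \<phi>'(3,4) have B1: "B1 \<noteq> 0" "cmod B1 = Re B1"
    by (auto simp: in_Reals_norm)
  have \<Phi>0: "fps_nth \<Phi> 0 = 1"
    by (simp add: \<Phi>_def fps_expansion_def \<phi>'(2))
  have comp: "fps_nth (\<Phi> oo U) 0 = 1" "fps_nth (\<Phi> oo U) 1 = B1 * c1"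
      "fps_nth (\<Phi> oo U) 2 = B1 * c2 + B2 * c1\<^sup>2"
    using U0 \<Phi>0
    by (simp_all add: fps_compose_nth coeff_defs numeral_2_eq_2 fps_mult_nth power2_eq_square)
  \<comment> \<open>The shift by one makes the coefficients of \<open>z\<close> and \<open>z\<^sup>2\<close> carry \<open>a\<^sub>2\<close> and \<open>a\<^sub>3\<close>.\<close>
  have "fps_nth ((\<Phi> oo U) * fps_shift 1 (fps_hadamard G F)) 1 = x * (x * a2)"
    "fps_nth ((\<Phi> oo U) * fps_shift 1 (fps_hadamard G F)) 2 = y * (y * a3)"
    unfolding eq by (simp_all add: coeff_defs numeral_2_eq_2 numeral_3_eq_3)
  hence e: "x * a2 + B1 * c1 = x * (x * a2)"
    "y * a3 + B1 * c1 * (x * a2) + (B1 * c2 + B2 * c1\<^sup>2) = y * (y * a3)"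
    using comp F G by (simp_all add: fps_mult_nth coeff_defs numeral_2_eq_2 numeral_3_eq_3)
  have a2: "a2 = B1 * c1 / (x * (x - 1))"
    using e(1) nz by (simp add: field_simps)
  have xa2: "x * a2 = B1 * c1 / (x - 1)"
    using nz by (simp add: a2)
  have "y * (y - 1) * a3 = B1 * c1 * (x * a2) + (B1 * c2 + B2 * c1\<^sup>2)"
    using e(2) by (simp add: algebra_simps)
  hence a3: "a3 = (B1 * c2 + (B2 + B1\<^sup>2 / (x - 1)) * c1\<^sup>2) / (y * (y - 1))"
    using nz unfolding xa2 by (simp add: eq_divide_eq power2_eq_square algebra_simps)
  define t where "t = B2 / B1 + B1 / (x - 1) * (1 - y * (y - 1) / (x\<^sup>2 * (x - 1)) * \<mu>)"
  have "B1 * t = B2 + B1\<^sup>2 / (x - 1) - y * (y - 1) * \<mu> * (B1 / (x * (x - 1)))\<^sup>2"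
  proof -
    have "(B1 / (x * (x - 1)))\<^sup>2 = B1\<^sup>2 / (x - 1) / (x\<^sup>2 * (x - 1))"
      by (simp add: power_divide power_mult_distrib power2_eq_square)
    moreover have "B1 * t = B2 + B1\<^sup>2 / (x - 1) * (1 - y * (y - 1) / (x\<^sup>2 * (x - 1)) * \<mu>)"
      using B1(1) by (simp add: t_def distrib_left power2_eq_square)
    ultimately show ?thesis
      by (simp add: right_diff_distrib)
  qed
  hence "B1 / (y * (y - 1)) * (c2 + t * c1\<^sup>2) = (B1 * c2 + (B2 + B1\<^sup>2 / (x - 1)
      - y * (y - 1) * \<mu> * (B1 / (x * (x - 1)))\<^sup>2) * c1\<^sup>2) / (y * (y - 1))"
    by (simp add: distrib_left add_divide_distrib flip: mult.assoc)
  also have "\<dots> = a3 - y * (y - 1) * \<mu> * (B1 / (x * (x - 1)))\<^sup>2 * c1\<^sup>2 / (y * (y - 1))"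
    unfolding a3 by (simp add: left_diff_distrib diff_divide_distrib add_divide_distrib)
  also have "\<dots> = a3 - \<mu> * a2\<^sup>2"
    using nz by (simp add: a2 power_divide power_mult_distrib)
  finally have "a3 - \<mu> * a2\<^sup>2 = B1 / (y * (y - 1)) * (c2 + t * c1\<^sup>2)" ..
  hence "cmod (a3 - \<mu> * a2\<^sup>2) = Re B1 / cmod (y * (y - 1)) * cmod (c2 + t * c1\<^sup>2)"
    by (simp add: norm_mult norm_divide B1(2))
  also have "\<dots> \<le> Re B1 / cmod (y * (y - 1)) * max 1 (cmod t)"
    unfolding c1_def c2_def using B1(2) norm_ge_zero[of B1]
    by (intro mult_left_mono Schwarz_Fekete_Szego[OF u]) auto
  finally show ?thesis
    unfolding tc t_def .
qed

end
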